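(* Let $K\ge 1$ and let $g_1,\dots,g_K$ be positive integers. Consider a $K$-plane point-mass lensing ensemble with $g_i$ point masses in the $i$-th plane: point-mass positions $y_{i,\ell}\in\mathbb{C}$ and scaled masses $m_{i,\ell}>0$ ($1\le i\le K$, $1\le \ell\le g_i$), and nonzero real scaling constants $\beta_{j,i}$ ($1\le j<i\le K$). Define the lensing map $\eta$ by $$\eta(x)=x-\sum_{k=1}^K \alpha_k(x_k),\qquad x_1=x,\quad x_i=x-\sum_{j=1}^{i-1}\beta_{j,i}\,\alpha_j(x_j)\ (i=2,\dots,K),\qquad \alpha_i(x_i)=\sum_{\ell=1}^{g_i}\frac{m_{i,\ell}}{\overline{x_i}-\overline{y_{i,\ell}}},$$ defined on $\mathbb{C}$ minus the obstruction points (those $x$ for which some denominator vanishes). Let $w\in\mathbb{C}$ be a source position that is not a critical value (caustic point) of $\eta$, and suppose the ensemble is generic. Let $F(Z)=\prod_{i=1}^K(1+g_iZ)$ and $$E_K=\frac{F(1)+F(-1)}{2},\qquad O_K=\frac{F(1)-F(-1)}{2},$$ i.e. the sums of the coefficients of the even-degree and odd-degree terms of $F$ respectively. Then the number $N$ of images, i.e. of solutions $x$ of $\eta(x)=w$, satisfies $$N\le E_K^2+O_K^2.$$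
   Context: Here $\mathbb{C}$ is identified with $\mathbb{R}^2$ and $\eta$ is regarded as a map $\mathbb{R}^2\setminus\{\text{obstruction points}\}\to\mathbb{R}^2$; the bar denotes complex conjugation. A critical point of $\eta_w(x)=\eta(x)-w$ is a point where the Jacobian determinant of $\eta$ vanishes; $w$ is a caustic point if it equals $\eta(x)$ for some critical point $x$. "Generic" means the parameters (positions, masses, scaling constants, source) are such that the lensing equation $\eta(x)=w$ has finitely many solutions, none of them degenerate (i.e. $w$ is not a caustic point). *)

theory Defs
  imports "HOL-Analysis.Analysis"
begin

text \<open>Lens ensemble parameters: planes are indexed 1..K, masses in plane i by 1..g i;
  y i l = position, m i l = scaled mass, beta j i = scaling constant (j < i).\<close>

definition lens_alpha ::
  "(nat \<Rightarrow> nat) \<Rightarrow> (nat \<Rightarrow> nat \<Rightarrow> complex) \<Rightarrow> (nat \<Rightarrow> nat \<Rightarrow> real) \<Rightarrow> nat \<Rightarrow> complex \<Rightarrow> complex"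
  where "lens_alpha g y m i z = (\<Sum>l=1..g i. complex_of_real (m i l) / (cnj z - cnj (y i l)))"

text \<open>lens_xs g y m beta x n = [x_1, ..., x_n]\<close>
primrec lens_xs ::
  "(nat \<Rightarrow> nat) \<Rightarrow> (nat \<Rightarrow> nat \<Rightarrow> complex) \<Rightarrow> (nat \<Rightarrow> nat \<Rightarrow> real) \<Rightarrow> (nat \<Rightarrow> nat \<Rightarrow> real)
    \<Rightarrow> complex \<Rightarrow> nat \<Rightarrow> complex list" where
  "lens_xs g y m beta x 0 = []"
| "lens_xs g y m beta x (Suc n) = lens_xs g y m beta x n @
     [x - (\<Sum>j<n. complex_of_real (beta (Suc j) (Suc n)) * lens_alpha g y m (Suc j) (lens_xs g y m beta x n ! j))]"

definition lens_pos ::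
  "(nat \<Rightarrow> nat) \<Rightarrow> (nat \<Rightarrow> nat \<Rightarrow> complex) \<Rightarrow> (nat \<Rightarrow> nat \<Rightarrow> real) \<Rightarrow> (nat \<Rightarrow> nat \<Rightarrow> real)
    \<Rightarrow> complex \<Rightarrow> nat \<Rightarrow> complex" where
  "lens_pos g y m beta x i = lens_xs g y m beta x i ! (i - 1)"

definition lens_map ::
  "nat \<Rightarrow> (nat \<Rightarrow> nat) \<Rightarrow> (nat \<Rightarrow> nat \<Rightarrow> complex) \<Rightarrow> (nat \<Rightarrow> nat \<Rightarrow> real) \<Rightarrow> (nat \<Rightarrow> nat \<Rightarrow> real)
    \<Rightarrow> complex \<Rightarrow> complex" where
  "lens_map K g y m beta x = x - (\<Sum>k=1..K. lens_alpha g y m k (lens_pos g y m beta x k))"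

definition lens_obstruction ::
  "nat \<Rightarrow> (nat \<Rightarrow> nat) \<Rightarrow> (nat \<Rightarrow> nat \<Rightarrow> complex) \<Rightarrow> (nat \<Rightarrow> nat \<Rightarrow> real) \<Rightarrow> (nat \<Rightarrow> nat \<Rightarrow> real)
    \<Rightarrow> complex set" where
  "lens_obstruction K g y m beta =
     {x. \<exists>i\<in>{1..K}. \<exists>l\<in>{1..g i}. lens_pos g y m beta x i = y i l}"

text \<open>Jacobian determinant of a real-linear map C -> C, C identified with R^2 via basis 1, i.\<close>
definition jac_det :: "(complex \<Rightarrow> complex) \<Rightarrow> real" where
  "jac_det D = Re (D 1) * Im (D \<i>) - Im (D 1) * Re (D \<i>)"

definition lens_critical ::
  "nat \<Rightarrow> (nat \<Rightarrow> nat) \<Rightarrow> (nat \<Rightarrow> nat \<Rightarrow> complex) \<Rightarrow> (nat \<Rightarrow> nat \<Rightarrow> real) \<Rightarrow> (nat \<Rightarrow> nat \<Rightarrow> real)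
    \<Rightarrow> complex \<Rightarrow> bool" where
  "lens_critical K g y m beta x \<longleftrightarrow> x \<notin> lens_obstruction K g y m beta \<and>
     (\<exists>D. (lens_map K g y m beta has_derivative D) (at x) \<and> jac_det D = 0)"

definition lens_caustic ::
  "nat \<Rightarrow> (nat \<Rightarrow> nat) \<Rightarrow> (nat \<Rightarrow> nat \<Rightarrow> complex) \<Rightarrow> (nat \<Rightarrow> nat \<Rightarrow> real) \<Rightarrow> (nat \<Rightarrow> nat \<Rightarrow> real)
    \<Rightarrow> complex \<Rightarrow> bool" where
  "lens_caustic K g y m beta w \<longleftrightarrow> (\<exists>x. lens_critical K g y m beta x \<and> lens_map K g y m beta x = w)"

definition lens_images ::
  "nat \<Rightarrow> (nat \<Rightarrow> nat) \<Rightarrow> (nat \<Rightarrow> nat \<Rightarrow> complex) \<Rightarrow> (nat \<Rightarrow> nat \<Rightarrow> real) \<Rightarrow> (nat \<Rightarrow> nat \<Rightarrow> real)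
    \<Rightarrow> complex \<Rightarrow> complex set" where
  "lens_images K g y m beta w = {x. x \<notin> lens_obstruction K g y m beta \<and> lens_map K g y m beta x = w}"

definition polyF :: "nat \<Rightarrow> (nat \<Rightarrow> nat) \<Rightarrow> real \<Rightarrow> real" where
  "polyF K g Z = (\<Prod>i=1..K. 1 + real (g i) * Z)"

definition E_K :: "nat \<Rightarrow> (nat \<Rightarrow> nat) \<Rightarrow> real" where
  "E_K K g = (polyF K g 1 + polyF K g (-1)) / 2"

definition O_K :: "nat \<Rightarrow> (nat \<Rightarrow> nat) \<Rightarrow> real" where
  "O_K K g = (polyF K g 1 - polyF K g (-1)) / 2"

end

theory Submission
  imports Defs "HOL-Computational_Algebra.Field_as_Ring" "Subresultants.Subresultant_Gcd"
begin

text \<open>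
  Off the obstruction points the equation \<open>\<eta>(x) = w\<close> is \<open>P(x, cnj x) = 0\<close> for a polynomial \<open>P(x, z)\<close>
  whose degrees in \<open>x\<close> and \<open>z\<close> are at most \<open>E\<^sub>K\<close> and \<open>O\<^sub>K\<close>; its conjugate is \<open>Q(x, cnj x) = 0\<close>
  with the two degrees interchanged. At an image the greatest common divisor of \<open>P\<close> and \<open>Q\<close>
  does not vanish, since otherwise the differentials of \<open>\<eta>\<close> and \<open>cnj \<circ> \<eta>\<close> would be proportional
  there and the Jacobian would be zero. Dividing it out leaves coprime polynomials, whose resultant
  with respect to \<open>z\<close> is a nonzero polynomial in \<open>x\<close> of degree at most \<open>E\<^sub>K\<^sup>2 + O\<^sub>K\<^sup>2\<close>
  that vanishes at every image.
\<close>

subsection \<open>Elimination for bivariate polynomials\<close>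

text \<open>In a \<open>poly poly\<close> the outer variable is \<open>z\<close> and the inner one is \<open>x\<close>.\<close>
definition eval2 :: "'a :: comm_semiring_1 poly poly \<Rightarrow> 'a \<Rightarrow> 'a \<Rightarrow> 'a" where
  "eval2 p x z = poly (poly p [:z:]) x"

lemma eval2_simps [simp]:
  "eval2 0 x z = 0"
  "eval2 [:[:c:]:] x z = c"
  "eval2 [:pCons 0 1:] x z = x"
  "eval2 (pCons 0 1) x z = z"
  "eval2 (p + q) x z = eval2 p x z + eval2 q x z"
  "eval2 (p * q) x z = eval2 p x z * eval2 q x z"
  by (simp_all add: eval2_def)

lemma eval2_altdef:
  assumes "degree p \<le> n"
  shows "eval2 p x z = (\<Sum>i\<le>n. poly (coeff p i) x * z ^ i)"
proof -
  have "poly p [:z:] = (\<Sum>i\<le>n. coeff p i * [:z:] ^ i)"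
    unfolding poly_altdef using assms by (intro sum.mono_neutral_left) (auto simp: coeff_eq_0)
  then show ?thesis
    by (simp add: eval2_def poly_sum)
qed

text \<open>The vector of descending powers of \<open>z\<close> lies in the kernel of the Sylvester
  matrix evaluated at \<open>x\<close>. Working with this fixed matrix avoids any assumption that
  the leading coefficients survive evaluation at \<open>x\<close>.\<close>

lemma resultant_common_root:
  fixes p q :: "'a :: field poly poly"
  assumes pos: "degree p + degree q > 0" and p: "eval2 p x z = 0" and q: "eval2 q x z = 0"
  shows "poly (resultant p q) x = 0"
proof -
  let ?m = "degree p" and ?n = "degree q"
  let ?N = "?m + ?n"
  let ?M = "map_mat (\<lambda>r. poly r x) (sylvester_mat p q)"
  let ?v = "Matrix.vec ?N (\<lambda>j. z ^ (?N - 1 - j))"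
  have M: "?M \<in> carrier_mat ?N ?N"
    by (simp add: sylvester_carrier_mat)
  have nz: "?v \<noteq> 0\<^sub>v ?N"
  proof
    assume "?v = 0\<^sub>v ?N"
    \<comment> \<open>The last entry is \<open>z ^ 0 = 1\<close>, so the vector is nonzero even for
      \<open>z = 0\<close>.\<close>
    then have "vec_index ?v (?N - 1) = vec_index (0\<^sub>v ?N) (?N - 1)" by simp
    then show False using pos by auto
  qed
  \<comment> \<open>Each row lists the coefficients of some \<open>z ^ k * r\<close> with
    \<open>r\<close> one of the two polynomials, so its product with \<open>?v\<close> is the value
    of that multiple. The extra shift in \<open>Suc k\<close> and \<open>?N - j\<close> follows the
    shape of \<open>sylvester_index_mat2\<close> and is cancelled below.\<close>
  have key: "(\<Sum>j<?N. poly (coeff (monom 1 (Suc k) * r) (?N - j)) x * z ^ (?N - 1 - j)) = 0"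
    if r: "eval2 r x z = 0" and k: "k + degree r < ?N" for r k
  proof -
    have "(\<Sum>j<?N. poly (coeff (monom 1 (Suc k) * r) (?N - j)) x * z ^ (?N - 1 - j)) =
      (\<Sum>j<?N. poly (coeff (monom 1 (Suc k) * r) (Suc j)) x * z ^ j)"
      by (rule sum.reindex_bij_witness[of _ "\<lambda>j. ?N - 1 - j" "\<lambda>j. ?N - 1 - j"])
        (auto simp: Suc_diff_Suc)
    also have "\<dots> = (\<Sum>j<?N. poly (coeff (monom 1 k * r) j) x * z ^ j)"
      by (rule sum.cong) (auto simp: coeff_monom_mult)
    also have "\<dots> = (\<Sum>j\<le>?N - 1. poly (coeff (monom 1 k * r) j) x * z ^ j)"
      using pos by (intro sum.cong) auto
    also have "\<dots> = eval2 (monom 1 k * r) x z"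
    proof (rule eval2_altdef[symmetric])
      show "degree (monom 1 k * r) \<le> ?N - 1"
        using k degree_mult_le[of "monom 1 k" r] degree_monom_le[of "1 :: 'a poly" k] by linarith
    qed
    also have "\<dots> = 0" using r by simp
    finally show ?thesis .
  qed
  have "?M *\<^sub>v ?v = 0\<^sub>v ?N"
  proof (rule eq_vecI)
    fix i assume "i < dim_vec (0\<^sub>v ?N :: 'a Matrix.vec)"
    then have i: "i < ?N" by simp
    have "vec_index (?M *\<^sub>v ?v) i =
      (\<Sum>j<?N. poly (sylvester_mat p q $$ (i, j)) x * z ^ (?N - 1 - j))"
      using i by (simp add: scalar_prod_def atLeast0LessThan)
    also have "\<dots> = 0"
    proof (cases "i < ?n")
      case True
      then have "(\<Sum>j<?N. poly (sylvester_mat p q $$ (i, j)) x * z ^ (?N - 1 - j)) =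
        (\<Sum>j<?N. poly (coeff (monom 1 (Suc (?n - 1 - i)) * p) (?N - j)) x * z ^ (?N - 1 - j))"
        using i by (intro sum.cong) (auto simp: sylvester_index_mat2 Suc_diff_Suc)
      also have "\<dots> = 0" using True by (intro key p) auto
      finally show ?thesis .
    next
      case False
      then have "(\<Sum>j<?N. poly (sylvester_mat p q $$ (i, j)) x * z ^ (?N - 1 - j)) =
        (\<Sum>j<?N. poly (coeff (monom 1 (Suc (?N - 1 - i)) * q) (?N - j)) x * z ^ (?N - 1 - j))"
        using i by (intro sum.cong) (auto simp: sylvester_index_mat2 Suc_diff_Suc)
      also have "\<dots> = 0" using False i by (intro key q) auto
      finally show ?thesis .
    qed
    finally show "vec_index (?M *\<^sub>v ?v) i = vec_index (0\<^sub>v ?N) i" using i by simp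
  qed simp
  with M nz have "Determinant.det ?M = 0"
    by (subst det_0_iff_vec_prod_zero_field[OF M]) (auto intro!: exI[of _ ?v])
  then show ?thesis
    by (simp add: resultant_def comm_ring_hom.hom_det[OF poly_hom.comm_ring_hom_axioms])
qed

text \<open>In the Leibniz expansion every term takes one entry from each row:
  \<open>degree q\<close> rows hold coefficients of \<open>p\<close> and \<open>degree p\<close>
  rows hold coefficients of \<open>q\<close>.\<close>

lemma degree_resultant_le:
  fixes p q :: "'a :: comm_ring_1 poly poly"
  assumes p: "\<And>i. degree (coeff p i) \<le> a" and q: "\<And>i. degree (coeff q i) \<le> c"
  shows "degree (resultant p q) \<le> a * degree q + c * degree p"
proof -
  let ?m = "degree p" and ?n = "degree q"
  let ?S = "sylvester_mat p q"
  define d where "d i = (if i < ?n then a else c)" for i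
  have d: "degree (?S $$ (i, j)) \<le> d i" if "i < ?m + ?n" "j < ?m + ?n" for i j
    using that p q by (auto simp: d_def sylvester_index_mat)
  have sum_d: "(\<Sum>i\<in>{0..<?m + ?n}. d i) = a * ?n + c * ?m"
  proof -
    have "{0..<?m + ?n} = {0..<?n} \<union> {?n..<?m + ?n}" by auto
    then have "(\<Sum>i\<in>{0..<?m + ?n}. d i) = (\<Sum>i\<in>{0..<?n}. d i) + (\<Sum>i\<in>{?n..<?m + ?n}. d i)"
      by (simp add: sum.union_disjoint)
    then show ?thesis by (simp add: d_def mult.commute)
  qed
  have "degree (signof \<pi> * (\<Prod>i = 0..<?m + ?n. ?S $$ (i, \<pi> i))) \<le> a * ?n + c * ?m"
    if \<pi>: "\<pi> permutes {0..<?m + ?n}" for \<pi>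
  proof -
    have "degree (signof \<pi> * (\<Prod>i = 0..<?m + ?n. ?S $$ (i, \<pi> i)))
      \<le> degree (\<Prod>i = 0..<?m + ?n. ?S $$ (i, \<pi> i))"
      by (cases "sign \<pi> = 1") (auto simp: sign_def)
    also have "\<dots> \<le> (\<Sum>i\<in>{0..<?m + ?n}. degree (?S $$ (i, \<pi> i)))"
      using degree_prod_sum_le[of "{0..<?m + ?n}" "\<lambda>i. ?S $$ (i, \<pi> i)"] by (simp add: o_def)
    also have "\<dots> \<le> (\<Sum>i\<in>{0..<?m + ?n}. d i)"
      using permutes_in_image[OF \<pi>] by (intro sum_mono d) auto
    finally show ?thesis unfolding sum_d .
  qed
  then show ?thesis
    unfolding resultant_def det_def'[OF sylvester_carrier_mat]
    by (intro degree_sum_le) (auto simp: finite_permutations)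
qed

text \<open>The coefficient of index \<open>i + j\<close>, with \<open>i\<close> and \<open>j\<close> minimal such that the coefficients of
  \<open>p\<close> and \<open>q\<close> have maximal degree, cannot cancel.\<close>
lemma degree_coeff_factor_le:
  fixes p q :: "'a :: idom poly poly"
  assumes pq: "\<And>i. degree (coeff (p * q) i) \<le> a" and q: "q \<noteq> 0"
  shows "degree (coeff p i) \<le> a"
proof (cases "p = 0")
  case False
  have max: "\<exists>i. coeff r i \<noteq> 0 \<and> (\<forall>j. degree (coeff r j) \<le> degree (coeff r i)) \<and>
      (\<forall>j<i. coeff r j = 0 \<or> degree (coeff r j) < degree (coeff r i))"
    if r: "r \<noteq> 0" for r :: "'a poly poly"
  proof -
    define D where "D = Max ((\<lambda>i. degree (coeff r i)) ` {..degree r})"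
    have D: "degree (coeff r j) \<le> D" for j
    proof (cases "j \<le> degree r")
      case True
      then show ?thesis unfolding D_def by (intro Max_ge) auto
    qed (simp add: coeff_eq_0)
    define Q where "Q = (\<lambda>i. coeff r i \<noteq> 0 \<and> degree (coeff r i) = D)"
    have "D \<in> (\<lambda>i. degree (coeff r i)) ` {..degree r}"
      unfolding D_def by (intro Max_in) auto
    then obtain k where k: "degree (coeff r k) = D" by auto
    \<comment> \<open>Zero coefficients also have degree 0, so for \<open>D = 0\<close> an index of
      maximal degree need not give a nonzero coefficient; the leading one does.\<close>
    have "\<exists>i. Q i"
    proof (cases "D = 0")
      case True
      then show ?thesis using r D[of "degree r"] unfolding Q_def by (intro exI[of _ "degree r"]) auto
    next
      case False
      then show ?thesis using k unfolding Q_def by (intro exI[of _ k]) auto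
    qed
    define s where "s = (LEAST i. Q i)"
    have Qs: "Q s" unfolding s_def by (rule LeastI_ex) fact
    have "coeff r j = 0 \<or> degree (coeff r j) < D" if "j < s" for j
      using not_less_Least[OF that[unfolded s_def]] D[of j] unfolding Q_def by auto
    with Qs D show ?thesis unfolding Q_def by (intro exI[of _ s]) auto
  qed
  obtain s where s: "coeff p s \<noteq> 0" "\<And>j. degree (coeff p j) \<le> degree (coeff p s)"
    "\<And>j. j < s \<Longrightarrow> coeff p j = 0 \<or> degree (coeff p j) < degree (coeff p s)"
    using max[OF False] by blast
  obtain t where t: "coeff q t \<noteq> 0" "\<And>j. degree (coeff q j) \<le> degree (coeff q t)"
    "\<And>j. j < t \<Longrightarrow> coeff q j = 0 \<or> degree (coeff q j) < degree (coeff q t)"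
    using max[OF q] by blast
  let ?A = "degree (coeff p s)" and ?B = "degree (coeff q t)"
  \<comment> \<open>If \<open>k\<close> differs from \<open>s\<close>, then \<open>k < s\<close> or
    \<open>s + t - k < t\<close>, and minimality makes the degree of one factor strictly smaller.
    Only \<open>k = s\<close> reaches degree \<open>?A + ?B\<close>.\<close>
  have "coeff (coeff p k * coeff q (s + t - k)) (?A + ?B) = 0" if "k \<noteq> s" "k \<le> s + t" for k
  proof (cases "coeff p k = 0 \<or> coeff q (s + t - k) = 0")
    case nz: False
    have "degree (coeff p k) + degree (coeff q (s + t - k)) < ?A + ?B"
    proof (cases "k < s")
      case True
      with s(3)[of k] t(2)[of "s + t - k"] nz show ?thesis by linarith
    next
      case False
      with that have "s + t - k < t" by linarith
      with t(3)[of "s + t - k"] s(2)[of k] nz show ?thesis by linarith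
    qed
    then show ?thesis
      using degree_mult_le[of "coeff p k" "coeff q (s + t - k)"] by (intro coeff_eq_0) linarith
  qed auto
  then have "coeff (coeff (p * q) (s + t)) (?A + ?B) =
      (\<Sum>k\<in>{s}. coeff (coeff p k * coeff q (s + t - k)) (?A + ?B))"
    unfolding coeff_mult[of p] coeff_sum by (intro sum.mono_neutral_right) auto
  also have "\<dots> = lead_coeff (coeff p s) * lead_coeff (coeff q t)"
    by (simp add: coeff_mult_degree_sum)
  also have "\<dots> \<noteq> 0" using s(1) t(1) by simp
  finally have "?A + ?B \<le> degree (coeff (p * q) (s + t))"
    by (rule le_degree)
  with pq[of "s + t"] s(2)[of i] show ?thesis by linarith
qed simp

text \<open>Eliminating \<open>z\<close> leaves a nonzero polynomial in \<open>x\<close>, so the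
  first coordinates of the common zeros are counted by its degree.\<close>

lemma coprime_common_roots_bound:
  fixes p q :: "complex poly poly"
  assumes cop: "coprime p q"
    and p: "degree p \<le> b" "\<And>i. degree (coeff p i) \<le> a"
    and q: "degree q \<le> d" "\<And>i. degree (coeff q i) \<le> c"
    and roots: "\<And>x. x \<in> X \<Longrightarrow> \<exists>z. eval2 p x z = 0 \<and> eval2 q x z = 0"
  shows "card X \<le> a * d + c * b"
proof (cases "degree p + degree q = 0")
  \<comment> \<open>Here \<open>z\<close> does not occur and the resultant is an empty determinant.
    Coprimality itself excludes a common linear factor in \<open>x\<close>.\<close>
  case True
  then obtain p0 q0 where pq: "p = [:p0:]" "q = [:q0:]"
    by (metis add_is_0 degree_eq_zeroE)
  have "X = {}"
  proof (rule equals0I)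
    fix x assume "x \<in> X"
    then have "[:-x, 1:] dvd p0" "[:-x, 1:] dvd q0"
      using roots[of x] by (auto simp: pq eval2_def poly_eq_0_iff_dvd)
    then have "[:[:-x, 1:]:] dvd p" "[:[:-x, 1:]:] dvd q"
      by (simp_all add: pq const_poly_dvd_const_poly_iff)
    with cop have "is_unit [:[:-x, 1:]:]" by (rule coprime_common_divisor)
    then show False by (simp add: is_unit_const_poly_iff is_unit_pCons_iff)
  qed
  then show ?thesis by simp
next
  case False
  have "resultant p q \<noteq> 0"
    using cop resultant_0_gcd[of p q] by simp
  then have "finite {x. poly (resultant p q) x = 0}"
    and "card {x. poly (resultant p q) x = 0} \<le> degree (resultant p q)"
    by (simp_all add: poly_roots_finite card_poly_roots_bound)
  moreover have "X \<subseteq> {x. poly (resultant p q) x = 0}"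
    using roots False by (auto intro: resultant_common_root)
  ultimately have "card X \<le> degree (resultant p q)"
    using card_mono order_trans by blast
  also have "\<dots> \<le> a * degree q + c * degree p"
    by (rule degree_resultant_le[OF p(2) q(2)])
  also have "\<dots> \<le> a * d + c * b"
    using p(1) q(1) by (intro add_mono mult_le_mono) auto
  finally show ?thesis .
qed

subsection \<open>Rational functions of a complex number and its conjugate\<close>

definition bipoly :: "nat \<Rightarrow> nat \<Rightarrow> (complex \<Rightarrow> complex) \<Rightarrow> bool" where
  "bipoly a b f \<longleftrightarrow> (\<exists>p. degree p \<le> b \<and> (\<forall>i. degree (coeff p i) \<le> a) \<and> (\<forall>x. f x = eval2 p x (cnj x)))"

lemma bipolyI:
  assumes "degree p \<le> b" "\<And>i. degree (coeff p i) \<le> a" "\<And>x. f x = eval2 p x (cnj x)"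
  shows "bipoly a b f"
  using assms unfolding bipoly_def by blast

lemma bipoly_mono: "bipoly a b f \<Longrightarrow> a \<le> a' \<Longrightarrow> b \<le> b' \<Longrightarrow> bipoly a' b' f"
  unfolding bipoly_def by (meson order_trans)

lemma bipoly_const: "bipoly a b (\<lambda>_. c)"
  by (rule bipolyI[of "[:[:c:]:]"]) (auto simp: coeff_pCons split: nat.split)

lemma bipoly_id: "bipoly 1 0 (\<lambda>x. x)"
  by (rule bipolyI[of "[:[:0, 1:]:]"]) (auto simp: coeff_pCons split: nat.split)

lemma bipoly_cnj_id: "bipoly 0 1 cnj"
  by (rule bipolyI[of "[:0, 1:]"]) (auto simp: coeff_pCons split: nat.split)

lemma bipoly_add:
  assumes "bipoly a b f" "bipoly a b g"
  shows "bipoly a b (\<lambda>x. f x + g x)"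
proof -
  obtain p q where "degree p \<le> b" "\<And>i. degree (coeff p i) \<le> a" "\<And>x. f x = eval2 p x (cnj x)"
    and "degree q \<le> b" "\<And>i. degree (coeff q i) \<le> a" "\<And>x. g x = eval2 q x (cnj x)"
    using assms unfolding bipoly_def by auto
  then show ?thesis by (intro bipolyI[of "p + q"]) (auto intro: degree_add_le)
qed

lemma bipoly_mult:
  assumes "bipoly a b f" "bipoly c d g"
  shows "bipoly (a + c) (b + d) (\<lambda>x. f x * g x)"
proof -
  obtain p q where p: "degree p \<le> b" "\<And>i. degree (coeff p i) \<le> a" "\<And>x. f x = eval2 p x (cnj x)"
    and q: "degree q \<le> d" "\<And>i. degree (coeff q i) \<le> c" "\<And>x. g x = eval2 q x (cnj x)"
    using assms unfolding bipoly_def by auto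
  show ?thesis
  proof (rule bipolyI)
    show "degree (p * q) \<le> b + d"
      using p(1) q(1) degree_mult_le[of p q] by linarith
    show "degree (coeff (p * q) i) \<le> a + c" for i
      unfolding coeff_mult by (intro degree_sum_le order.trans[OF degree_mult_le] add_mono p q) auto
  qed (simp add: p q)
qed

lemma bipoly_diff:
  assumes "bipoly a b f" "bipoly a b g"
  shows "bipoly a b (\<lambda>x. f x - g x)"
proof -
  have "bipoly a b (\<lambda>x. - 1 * g x)"
    using bipoly_mult[OF bipoly_const[of 0 0 "-1"] assms(2)] by simp
  from bipoly_add[OF assms(1) this] show ?thesis by simp
qed

lemma bipoly_sum:
  assumes "\<And>i. i \<in> I \<Longrightarrow> bipoly a b (f i)"
  shows "bipoly a b (\<lambda>x. \<Sum>i\<in>I. f i x)"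
  using assms by (induction I rule: infinite_finite_induct) (auto intro: bipoly_const bipoly_add)

lemma bipoly_power: "bipoly a b f \<Longrightarrow> bipoly (n * a) (n * b) (\<lambda>x. f x ^ n)"
  by (induction n) (auto intro: bipoly_const bipoly_mult)

text \<open>Conjugation exchanges \<open>x\<close> and \<open>cnj x\<close>. Padding both sums to
  the fixed bounds makes each conjugated term a polynomial in \<open>cnj x\<close> of degree at most
  \<open>a\<close> times a power \<open>x ^ i\<close> with \<open>i \<le> b\<close>.\<close>

lemma bipoly_cnj:
  assumes "bipoly a b f"
  shows "bipoly b a (\<lambda>x. cnj (f x))"
proof -
  obtain p where p: "degree p \<le> b" "\<And>i. degree (coeff p i) \<le> a" "\<And>x. f x = eval2 p x (cnj x)"
    using assms unfolding bipoly_def by auto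
  have "f x = (\<Sum>i\<le>b. (\<Sum>j\<le>a. coeff (coeff p i) j * x ^ j) * cnj x ^ i)" for x
    unfolding p(3) eval2_altdef[OF p(1)] poly_altdef
    by (intro sum.cong refl arg_cong2[of _ _ _ _ "(*)"] sum.mono_neutral_left)
      (use p(2) in \<open>auto intro: coeff_eq_0\<close>)
  then have f: "cnj (f x) = (\<Sum>i\<le>b. (\<Sum>j\<le>a. cnj (coeff (coeff p i) j) * cnj x ^ j) * x ^ i)" for x
    by (simp add: cnj_sum)
  have "bipoly b a (\<lambda>x. (\<Sum>j\<le>a. cnj (coeff (coeff p i) j) * cnj x ^ j) * x ^ i)" if "i \<le> b" for i
  proof -
    have "bipoly 0 a (\<lambda>x. cnj (coeff (coeff p i) j) * cnj x ^ j)" if "j \<le> a" for j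
      by (rule bipoly_mono[OF bipoly_mult[OF bipoly_const[of 0 0] bipoly_power[OF bipoly_cnj_id]]])
        (use that in auto)
    then have "bipoly 0 a (\<lambda>x. \<Sum>j\<le>a. cnj (coeff (coeff p i) j) * cnj x ^ j)"
      by (intro bipoly_sum) auto
    from bipoly_mult[OF this bipoly_power[OF bipoly_id]] show ?thesis
      by (rule bipoly_mono) (use that in auto)
  qed
  then show ?thesis unfolding f by (intro bipoly_sum) auto
qed

text \<open>Only real differentiability is available because of \<open>cnj\<close>; the coefficients
  are holomorphic, and hence real differentiable.\<close>

lemma eval2_real_differentiable:
  "(\<lambda>x. eval2 p x (cnj x)) differentiable (at (x0 :: complex))"
proof -
  have "(\<lambda>x. poly (coeff p i) x * cnj x ^ i) differentiable at x0" for i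
  proof -
    have "poly (coeff p i) field_differentiable at x0"
      using poly_DERIV field_differentiable_def by blast
    then have "poly (coeff p i) differentiable at x0"
      by (rule field_differentiable_imp_differentiable)
    moreover have "cnj differentiable at x0"
      using bounded_linear_cnj bounded_linear_imp_differentiable by blast
    ultimately show ?thesis by (intro differentiable_mult differentiable_power) auto
  qed
  then show ?thesis
    unfolding eval2_altdef[OF order_refl] by (intro differentiable_sum) auto
qed

lemma bipoly_differentiable: "bipoly a b f \<Longrightarrow> f differentiable (at x)"
  using eval2_real_differentiable unfolding bipoly_def by (metis ext)

text \<open>Numerator and denominator share their bounds, so that taking a reciprocal does not
  change the degrees.\<close>

definition ratform :: "complex set \<Rightarrow> nat \<Rightarrow> nat \<Rightarrow> (complex \<Rightarrow> complex) \<Rightarrow> bool" where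
  "ratform U a b h \<longleftrightarrow> (\<exists>N D. bipoly a b N \<and> bipoly a b D \<and> (\<forall>x\<in>U. D x \<noteq> 0 \<and> h x = N x / D x))"

lemma ratform_subset: "ratform U a b h \<Longrightarrow> V \<subseteq> U \<Longrightarrow> ratform V a b h"
  unfolding ratform_def by blast

lemma ratform_bipoly: "bipoly a b f \<Longrightarrow> ratform U a b f"
  unfolding ratform_def using bipoly_const[of a b 1] by (intro exI[of _ f] exI[of _ "\<lambda>_. 1"]) auto

lemma ratform_add:
  assumes "ratform U a b f" "ratform U c d g"
  shows "ratform U (a + c) (b + d) (\<lambda>x. f x + g x)"
proof -
  obtain N D where 1: "bipoly a b N" "bipoly a b D" "\<And>x. x \<in> U \<Longrightarrow> D x \<noteq> 0" "\<And>x. x \<in> U \<Longrightarrow> f x = N x / D x"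
    using assms(1) unfolding ratform_def by blast
  obtain N' D' where 2: "bipoly c d N'" "bipoly c d D'" "\<And>x. x \<in> U \<Longrightarrow> D' x \<noteq> 0" "\<And>x. x \<in> U \<Longrightarrow> g x = N' x / D' x"
    using assms(2) unfolding ratform_def by blast
  have "bipoly (a + c) (b + d) (\<lambda>x. N x * D' x + D x * N' x)"
    "bipoly (a + c) (b + d) (\<lambda>x. D x * D' x)"
    using 1 2 by (auto intro!: bipoly_add bipoly_mult)
  moreover have "\<forall>x\<in>U. D x * D' x \<noteq> 0 \<and> f x + g x = (N x * D' x + D x * N' x) / (D x * D' x)"
    using 1 2 by (simp add: add_frac_eq mult.commute)
  ultimately show ?thesis unfolding ratform_def by blast
qed

lemma ratform_cmult:
  assumes "ratform U a b f"
  shows "ratform U a b (\<lambda>x. c * f x)"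
proof -
  obtain N D where 1: "bipoly a b N" "bipoly a b D" "\<And>x. x \<in> U \<Longrightarrow> D x \<noteq> 0" "\<And>x. x \<in> U \<Longrightarrow> f x = N x / D x"
    using assms unfolding ratform_def by blast
  have "bipoly a b (\<lambda>x. c * N x)"
    using bipoly_mult[OF bipoly_const[of 0 0 c] 1(1)] by simp
  with 1 show ?thesis unfolding ratform_def by (intro exI[of _ "\<lambda>x. c * N x"] exI[of _ D]) auto
qed

lemma ratform_sum:
  assumes "finite I" "\<And>i. i \<in> I \<Longrightarrow> ratform U (a i) (b i) (f i)"
  shows "ratform U (\<Sum>i\<in>I. a i) (\<Sum>i\<in>I. b i) (\<lambda>x. \<Sum>i\<in>I. f i x)"
  using assms by (induction I rule: finite_induct) (auto intro: ratform_add ratform_bipoly bipoly_const)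

lemma ratform_cnj:
  assumes "ratform U a b f"
  shows "ratform U b a (\<lambda>x. cnj (f x))"
proof -
  obtain N D where "bipoly a b N" "bipoly a b D" "\<And>x. x \<in> U \<Longrightarrow> D x \<noteq> 0" "\<And>x. x \<in> U \<Longrightarrow> f x = N x / D x"
    using assms unfolding ratform_def by blast
  then show ?thesis unfolding ratform_def
    by (intro exI[of _ "\<lambda>x. cnj (N x)"] exI[of _ "\<lambda>x. cnj (D x)"]) (auto intro: bipoly_cnj)
qed

text \<open>Clearing denominators gives \<open>r * D / (N - c * D)\<close>, whose numerator and
  denominator obey the old bounds.\<close>

lemma ratform_pole:
  assumes "ratform U a b f" and c: "\<And>x. x \<in> U \<Longrightarrow> f x \<noteq> c"
  shows "ratform U a b (\<lambda>x. r / (f x - c))"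
proof -
  obtain N D where 1: "bipoly a b N" "bipoly a b D" "\<And>x. x \<in> U \<Longrightarrow> D x \<noteq> 0" "\<And>x. x \<in> U \<Longrightarrow> f x = N x / D x"
    using assms(1) unfolding ratform_def by blast
  have "bipoly a b (\<lambda>x. r * D x)" "bipoly a b (\<lambda>x. c * D x)"
    using bipoly_mult[OF bipoly_const[of 0 0] 1(2)] by simp_all
  moreover have "\<forall>x\<in>U. N x - c * D x \<noteq> 0 \<and> r / (f x - c) = r * D x / (N x - c * D x)"
  proof
    fix x assume x: "x \<in> U"
    have eq: "N x - c * D x = (f x - c) * D x"
      using 1(3,4)[OF x] by (simp add: field_simps)
    then show "N x - c * D x \<noteq> 0 \<and> r / (f x - c) = r * D x / (N x - c * D x)"
      unfolding eq using 1(3)[OF x] c[OF x] by simp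
  qed
  ultimately show ?thesis
    unfolding ratform_def using bipoly_diff[OF 1(1)] by blast
qed

lemma ratform_continuous_on:
  assumes "ratform U a b f"
  shows "continuous_on U f"
proof -
  obtain N D where 1: "bipoly a b N" "bipoly a b D" "\<And>x. x \<in> U \<Longrightarrow> D x \<noteq> 0" "\<And>x. x \<in> U \<Longrightarrow> f x = N x / D x"
    using assms unfolding ratform_def by blast
  have "continuous_on U N" "continuous_on U D"
    using 1(1,2)[THEN bipoly_differentiable]
    by (auto intro!: continuous_at_imp_continuous_on differentiable_imp_continuous_within)
  then have "continuous_on U (\<lambda>x. N x / D x)"
    using 1(3) by (intro continuous_on_divide) auto
  then show ?thesis by (rule continuous_on_eq) (simp add: 1(4))
qed

subsection \<open>The lens map\<close>

lemma length_lens_xs [simp]: "length (lens_xs g y m \<beta> x n) = n"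
  by (induction n) simp_all

lemma lens_xs_nth:
  assumes "j < n"
  shows "lens_xs g y m \<beta> x n ! j = lens_pos g y m \<beta> x (Suc j)"
  using assms
proof (induction n)
  case (Suc n)
  then show ?case
    by (cases "j = n") (simp_all add: nth_append lens_pos_def)
qed simp

lemma lens_pos_Suc:
  "lens_pos g y m \<beta> x (Suc n) =
    x - (\<Sum>j<n. complex_of_real (\<beta> (Suc j) (Suc n)) *
      lens_alpha g y m (Suc j) (lens_pos g y m \<beta> x (Suc j)))"
  by (simp add: lens_pos_def[of _ _ _ _ _ "Suc n"] nth_append lens_xs_nth)

text \<open>Counting only the first \<open>n\<close> planes permits induction over the planes; for
  \<open>n = K\<close> this is the domain of the lens map.\<close>

definition unobstructed ::
  "(nat \<Rightarrow> nat) \<Rightarrow> (nat \<Rightarrow> nat \<Rightarrow> complex) \<Rightarrow> (nat \<Rightarrow> nat \<Rightarrow> real) \<Rightarrow> (nat \<Rightarrow> nat \<Rightarrow> real)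
    \<Rightarrow> nat \<Rightarrow> complex set" where
  "unobstructed g y m \<beta> n =
    {x. \<forall>i<n. \<forall>l\<in>{1..g (Suc i)}. lens_pos g y m \<beta> x (Suc i) \<noteq> y (Suc i) l}"

lemma unobstructed_altdef: "unobstructed g y m \<beta> K = - lens_obstruction K g y m \<beta>"
proof -
  have "{1..K} = Suc ` {..<K}"
    by (simp add: image_Suc_lessThan)
  then show ?thesis
    unfolding unobstructed_def lens_obstruction_def by auto
qed

text \<open>These are the sums of the even and odd coefficients of the product of the first
  \<open>n\<close> factors \<open>1 + g i * Z\<close>; the recursion is multiplication by the next
  factor.\<close>

fun even_deg odd_deg :: "(nat \<Rightarrow> nat) \<Rightarrow> nat \<Rightarrow> nat" where
  "even_deg g 0 = 1"
| "odd_deg g 0 = 0"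
| "even_deg g (Suc n) = even_deg g n + g (Suc n) * odd_deg g n"
| "odd_deg g (Suc n) = odd_deg g n + g (Suc n) * even_deg g n"

text \<open>The unrolled form mirrors \<open>lens_pos_Suc\<close>: the 1 is the degree of the term
  \<open>x\<close>, and the summands come from the earlier deflections.\<close>

lemma even_deg_sum: "even_deg g n = 1 + (\<Sum>j<n. g (Suc j) * odd_deg g j)"
  by (induction n) auto

lemma odd_deg_sum: "odd_deg g n = (\<Sum>j<n. g (Suc j) * even_deg g j)"
  by (induction n) auto

lemma polyF_one: "polyF n g 1 = real (even_deg g n) + real (odd_deg g n)"
  by (induction n) (auto simp: polyF_def algebra_simps)

lemma polyF_minus_one: "polyF n g (-1) = real (even_deg g n) - real (odd_deg g n)"
proof (induction n)
  case (Suc n)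
  have "polyF (Suc n) g (-1) = polyF n g (-1) * (1 - real (g (Suc n)))"
    by (simp add: polyF_def mult.commute)
  then show ?case by (simp add: Suc algebra_simps)
qed (simp add: polyF_def)

lemma E_K_eq: "E_K n g = real (even_deg g n)"
  and O_K_eq: "O_K n g = real (odd_deg g n)"
  by (simp_all add: E_K_def O_K_def polyF_one polyF_minus_one)

text \<open>Conjugation interchanges the two degrees, so the deflection in plane n + 1 adds g (n + 1)
  times the odd degree to the even degree and vice versa.\<close>
lemma ratform_lens_alpha:
  "ratform (unobstructed g y m \<beta> (Suc n)) (g (Suc n) * odd_deg g n) (g (Suc n) * even_deg g n)
    (\<lambda>x. lens_alpha g y m (Suc n) (lens_pos g y m \<beta> x (Suc n)))"
proof (induction n rule: less_induct)
  case (less n)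
  let ?U = "unobstructed g y m \<beta> (Suc n)"
  let ?\<alpha> = "\<lambda>j x. lens_alpha g y m (Suc j) (lens_pos g y m \<beta> x (Suc j))"
  have "ratform ?U (\<Sum>j<n. g (Suc j) * odd_deg g j) (\<Sum>j<n. g (Suc j) * even_deg g j)
    (\<lambda>x. \<Sum>j<n. - complex_of_real (\<beta> (Suc j) (Suc n)) * ?\<alpha> j x)"
    by (intro ratform_sum ratform_cmult ratform_subset[OF less.IH]) (auto simp: unobstructed_def)
  from ratform_add[OF ratform_bipoly[OF bipoly_id] this]
  have "ratform ?U (even_deg g n) (odd_deg g n) (\<lambda>x. lens_pos g y m \<beta> x (Suc n))"
    unfolding even_deg_sum[of g n] odd_deg_sum[of g n] lens_pos_Suc[where n = n]
    by (simp add: sum_negf)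
  then have cnj: "ratform ?U (odd_deg g n) (even_deg g n) (\<lambda>x. cnj (lens_pos g y m \<beta> x (Suc n)))"
    by (rule ratform_cnj)
  \<comment> \<open>The point masses contribute separate denominators, so the degrees are added
    \<open>g (Suc n)\<close> times.\<close>
  have "ratform ?U (\<Sum>l = 1..g (Suc n). odd_deg g n) (\<Sum>l = 1..g (Suc n). even_deg g n)
    (\<lambda>x. \<Sum>l = 1..g (Suc n). complex_of_real (m (Suc n) l) /
      (cnj (lens_pos g y m \<beta> x (Suc n)) - cnj (y (Suc n) l)))"
    by (intro ratform_sum ratform_pole[OF cnj]) (auto simp: unobstructed_def)
  then show ?case by (simp add: lens_alpha_def)
qed

text \<open>The next position is continuous where the earlier planes are unobstructed, and avoiding
  finitely many masses is an open condition. Openness is needed to differentiate identities that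
  hold only on this set.\<close>

lemma open_unobstructed: "open (unobstructed g y m \<beta> n)"
proof (induction n)
  case (Suc n)
  let ?U = "unobstructed g y m \<beta>"
  have "continuous_on (?U n) (\<lambda>x. lens_pos g y m \<beta> x (Suc n))"
    unfolding lens_pos_Suc[where n = n]
    by (intro continuous_intros ratform_continuous_on[OF ratform_subset[OF ratform_lens_alpha]])
      (auto simp: unobstructed_def)
  then have "open ((\<lambda>x. lens_pos g y m \<beta> x (Suc n)) -` (- y (Suc n) ` {1..g (Suc n)}) \<inter> ?U n)"
    using Suc by (simp add: continuous_on_open_vimage finite_imp_closed open_Compl)
  also have "(\<lambda>x. lens_pos g y m \<beta> x (Suc n)) -` (- y (Suc n) ` {1..g (Suc n)}) \<inter> ?U n = ?U (Suc n)"
    by (auto simp: unobstructed_def less_Suc_eq)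
  finally show ?case .
qed (simp add: unobstructed_def)

text \<open>The lens map has the shape of a position in a further plane \<open>K + 1\<close> with
  all scaling constants equal to 1, and subtracting \<open>w\<close> leaves the degrees
  unchanged.\<close>

lemma ratform_lens_map:
  "ratform (unobstructed g y m \<beta> K) (even_deg g K) (odd_deg g K) (\<lambda>x. lens_map K g y m \<beta> x - w)"
proof -
  let ?U = "unobstructed g y m \<beta> K"
  have "ratform ?U (\<Sum>j<K. g (Suc j) * odd_deg g j) (\<Sum>j<K. g (Suc j) * even_deg g j)
    (\<lambda>x. \<Sum>j<K. - 1 * lens_alpha g y m (Suc j) (lens_pos g y m \<beta> x (Suc j)))"
    by (intro ratform_sum ratform_cmult ratform_subset[OF ratform_lens_alpha]) (auto simp: unobstructed_def)
  moreover have "bipoly 1 0 (\<lambda>x. x - w)"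
    by (intro bipoly_diff bipoly_id bipoly_const)
  ultimately have "ratform ?U (even_deg g K) (odd_deg g K)
    (\<lambda>x. (x - w) + (\<Sum>j<K. - 1 * lens_alpha g y m (Suc j) (lens_pos g y m \<beta> x (Suc j))))"
    unfolding even_deg_sum[of g K] odd_deg_sum[of g K]
    using ratform_add[OF ratform_bipoly] by fastforce
  moreover have "(\<Sum>k = 1..K. f k) = (\<Sum>j<K. f (Suc j))" for f :: "nat \<Rightarrow> complex"
    by (metis One_nat_def atLeastLessThanSuc_atLeastAtMost atLeast0LessThan sum.shift_bounds_Suc_ivl)
  ultimately show ?thesis
    by (simp add: lens_map_def sum_negf algebra_simps)
qed

section \<open>Vanishing of the Jacobian at zeros of a common factor\<close>

lemma has_derivative_mult_root:
  fixes u v :: "'a :: real_normed_vector \<Rightarrow> 'b :: real_normed_algebra"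
  assumes "u differentiable (at x)" and v: "(v has_derivative D) (at x)" "v x = 0"
  shows "((\<lambda>t. u t * v t) has_derivative (\<lambda>h. u x * D h)) (at x)"
proof -
  obtain E where "(u has_derivative E) (at x)"
    using assms(1) by (auto simp: differentiable_def)
  from has_derivative_mult[OF this v(1)] show ?thesis by (simp add: v(2))
qed

text \<open>The Jacobian is the imaginary part of \<open>cnj (D 1) * D \<i>\<close>. Both this
  product and its conjugate equal \<open>c * d * L 1 * L \<i>\<close>, so it is real.\<close>

lemma jac_det_eq_0:
  assumes "\<And>h. D h = c * L h" "\<And>h. cnj (D h) = d * L h"
  shows "jac_det D = 0"
proof -
  have "cnj (D 1) * D \<i> = D 1 * cnj (D \<i>)"
    unfolding assms(2) by (simp add: assms(1))
  then have "Im (cnj (D 1) * D \<i>) = Im (D 1 * cnj (D \<i>))" by simp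
  then show ?thesis by (simp add: jac_det_def algebra_simps)
qed

text \<open>Where \<open>v\<close> vanishes the product rule keeps only the derivative of
  \<open>v\<close>. The derivatives of \<open>f\<close> and \<open>cnj f\<close> are therefore
  multiples of the same map \<open>L\<close>.\<close>

lemma common_factor_critical:
  fixes f :: "complex \<Rightarrow> complex"
  assumes U: "open U" "x \<in> U"
    and f: "\<And>t. t \<in> U \<Longrightarrow> f t = u t * v t" "\<And>t. t \<in> U \<Longrightarrow> cnj (f t) = u' t * v t"
    and uv: "u differentiable (at x)" "u' differentiable (at x)" "v differentiable (at x)" "v x = 0"
  obtains D where "(f has_derivative D) (at x)" "jac_det D = 0"
proof -
  obtain L where L: "(v has_derivative L) (at x)"
    using uv(3) by (auto simp: differentiable_def)
  have D: "(f has_derivative (\<lambda>h. u x * L h)) (at x)"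
    by (rule has_derivative_transform_within_open[OF has_derivative_mult_root[OF uv(1) L uv(4)] U])
      (simp add: f)
  have "((\<lambda>t. cnj (f t)) has_derivative (\<lambda>h. u' x * L h)) (at x)"
    by (rule has_derivative_transform_within_open[OF has_derivative_mult_root[OF uv(2) L uv(4)] U])
      (simp flip: f(2))
  moreover have "((\<lambda>t. cnj (f t)) has_derivative (\<lambda>h. cnj (u x * L h))) (at x)"
    by (rule has_derivative_cnj[OF D])
  \<comment> \<open>The derivative of \<open>cnj f\<close> has been computed in two ways: from its
    own factorisation and by conjugating that of \<open>f\<close>.\<close>
  ultimately have "(\<lambda>h. cnj (u x * L h)) = (\<lambda>h. u' x * L h)"
    by (rule has_derivative_unique[rotated])
  then have "jac_det (\<lambda>h. u x * L h) = 0"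
    by (intro jac_det_eq_0[of _ "u x" L "u' x"]) (auto dest: fun_cong)
  with D show ?thesis by (rule that)
qed

section \<open>Counting the images by elimination\<close>

theorem theorem1:
  fixes K :: nat and g :: "nat \<Rightarrow> nat" and y :: "nat \<Rightarrow> nat \<Rightarrow> complex"
    and m :: "nat \<Rightarrow> nat \<Rightarrow> real" and beta :: "nat \<Rightarrow> nat \<Rightarrow> real" and w :: complex
  assumes "K \<ge> 1"
    and "\<forall>i\<in>{1..K}. g i > 0"
    and "\<forall>i\<in>{1..K}. \<forall>l\<in>{1..g i}. m i l > 0"
    and "\<forall>i\<in>{1..K}. \<forall>j\<in>{1..<i}. beta j i \<noteq> 0"
    and "\<not> lens_caustic K g y m beta w"
    and "finite (lens_images K g y m beta w)"
  shows "real (card (lens_images K g y m beta w)) \<le> (E_K K g)^2 + (O_K K g)^2"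
proof (cases "lens_images K g y m beta w = {}")
  case True
  then show ?thesis by simp
next
  case False
  let ?X = "lens_images K g y m beta w"
  let ?f = "\<lambda>x. lens_map K g y m beta x - w"
  let ?a = "even_deg g K" and ?b = "odd_deg g K"
  define U where "U = unobstructed g y m beta K"
  have U: "open U" unfolding U_def by (rule open_unobstructed)
  have X: "?X = {x \<in> U. ?f x = 0}"
    by (auto simp: lens_images_def U_def unobstructed_altdef)
  obtain N D where N: "bipoly ?a ?b N" and D: "bipoly ?a ?b D"
    and D0: "\<And>x. x \<in> U \<Longrightarrow> D x \<noteq> 0" and ND: "\<And>x. x \<in> U \<Longrightarrow> ?f x = N x / D x"
    using ratform_lens_map[of g y m beta K w] unfolding U_def ratform_def by blast
  obtain p where p: "degree p \<le> ?b" "\<And>i. degree (coeff p i) \<le> ?a" "\<And>x. N x = eval2 p x (cnj x)"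
    using N unfolding bipoly_def by blast
  obtain q where q: "degree q \<le> ?a" "\<And>i. degree (coeff q i) \<le> ?b" "\<And>x. cnj (N x) = eval2 q x (cnj x)"
    using bipoly_cnj[OF N] unfolding bipoly_def by blast
  \<comment> \<open>The gcd is taken in the ring of polynomials in both variables, so it also
    absorbs common factors that depend on \<open>x\<close> alone.\<close>
  define H where "H = gcd p q"
  obtain p' q' where pq: "p = p' * H" "q = q' * H"
    unfolding H_def by (metis dvd_div_mult_self gcd_dvd1 gcd_dvd2)
  have H: "eval2 H x (cnj x) \<noteq> 0" if x: "x \<in> ?X" for x
  proof
    assume Hx: "eval2 H x (cnj x) = 0"
    let ?h = "\<lambda>x. eval2 H x (cnj x)"
    \<comment> \<open>The denominators \<open>D\<close> and \<open>cnj D\<close> go into the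
      cofactors, leaving the same factor \<open>?h\<close> in \<open>?f\<close> and in its
      conjugate.\<close>
    let ?u = "\<lambda>x. eval2 p' x (cnj x) / D x" and ?u' = "\<lambda>x. eval2 q' x (cnj x) / cnj (D x)"
    have xU: "x \<in> U" using x X by auto
    obtain L where L: "(?f has_derivative L) (at x)" "jac_det L = 0"
    proof (rule common_factor_critical)
      show "?f t = ?u t * ?h t" if "t \<in> U" for t
        using ND[OF that] by (simp add: p pq)
      show "cnj (?f t) = ?u' t * ?h t" if "t \<in> U" for t
        unfolding ND[OF that] complex_cnj_divide q by (simp add: pq)
      show "?u differentiable (at x)"
        using D0[OF xU] by (intro differentiable_divide eval2_real_differentiable bipoly_differentiable[OF D])
      show "?u' differentiable (at x)"
        using D0[OF xU]
        by (intro differentiable_divide eval2_real_differentiable bipoly_differentiable[OF bipoly_cnj[OF D]]) simp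
    qed (use U xU Hx eval2_real_differentiable in auto)
    from L(1) have "((\<lambda>t. ?f t + w) has_derivative L) (at x)"
      by (intro has_derivative_eq_rhs[OF has_derivative_add[OF _ has_derivative_const]]) auto
    then have "(lens_map K g y m beta has_derivative L) (at x)" by simp
    with L(2) x assms(5) show False
      unfolding lens_caustic_def lens_critical_def lens_images_def by blast
  qed
  \<comment> \<open>The existence of an image, from the case split, rules out
    \<open>p = q = 0\<close>, for which the gcd would be zero.\<close>
  have H0: "H \<noteq> 0" using False H by auto
  then have cop: "coprime p' q'"
    using gcd_coprime pq unfolding H_def by blast
  \<comment> \<open>The degrees of \<open>p'\<close> in \<open>x\<close> and of \<open>q'\<close> in
    \<open>z\<close> are bounded by \<open>?a\<close>, the other two by \<open>?b\<close>; the mixed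
    products in the resultant bound thus become squares.\<close>
  have "card ?X \<le> ?a * ?a + ?b * ?b"
  proof (rule coprime_common_roots_bound[OF cop])
    show "degree p' \<le> ?b" using p(1) H0 degree_mult_right_le[of H p'] unfolding pq(1) by simp
    show "degree q' \<le> ?a" using q(1) H0 degree_mult_right_le[of H q'] unfolding pq(2) by simp
    show "degree (coeff p' i) \<le> ?a" for i
      using degree_coeff_factor_le[of p' H] p(2) H0 by (simp add: pq)
    show "degree (coeff q' i) \<le> ?b" for i
      using degree_coeff_factor_le[of q' H] q(2) H0 by (simp add: pq)
    \<comment> \<open>The witness is \<open>cnj x\<close>; the factor \<open>H\<close> is nonzero at
      an image and cancels.\<close>
    show "\<exists>z. eval2 p' x z = 0 \<and> eval2 q' x z = 0" if x: "x \<in> ?X" for x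
    proof -
      have "N x = 0" using x ND[of x] D0[of x] unfolding X by auto
      then have "eval2 p x (cnj x) = 0" "eval2 q x (cnj x) = 0"
        by (simp_all flip: p(3) q(3))
      with H[OF x] show ?thesis by (auto simp: pq)
    qed
  qed
  then have "real (card ?X) \<le> real (?a * ?a + ?b * ?b)"
    by (simp only: of_nat_le_iff)
  then show ?thesis by (simp add: E_K_eq O_K_eq power2_eq_square)
qed

end
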